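(* Let $\gamma$ be a modulus function and let $\mathcal{AC}_\gamma$ be the set of all functions $f:\mathbb{R}\to\mathbb{R}$ that are $\gamma$-approximately continuous at every $x\in\mathbb{R}$. Then $\mathcal{AC}_\gamma$, equipped with the usual pointwise addition and scalar multiplication, is a vector space over $\mathbb{R}$.
   Context: $|\cdot|$ denotes Lebesgue measure on $\mathbb{R}$ and $A^c=\mathbb{R}\setminus A$. A modulus function is a function $\gamma:[0,\infty)\to[0,\infty)$ such that (i) $\gamma(a)=0\Leftrightarrow a=0$; (ii) $\gamma(a+b)\le\gamma(a)+\gamma(b)$ for all $a,b\ge 0$; (iii) $\gamma$ is right-continuous at $0$; (iv) $\gamma$ is increasing (in the weak sense: $a\le b$ implies $\gamma(a)\le\gamma(b)$). For a Lebesgue measurable $A\subset\mathbb{R}$, $\mathcal{D}_\gamma(A)$ is the set of all $x\in\mathbb{R}$ with $\lim_{\alpha\to 0^+}\frac{\gamma(|(x-\alpha,x+\alpha)\cap A^c|)}{\gamma(2\alpha)}=0$. A function $f:\mathbb{R}\to\mathbb{R}$ is $\gamma$-approximately continuous at $x_0\in\mathbb{R}$ if there exists a Lebesgue measurable set $A_{x_0}\subset\mathbb{R}$ such that $x_0\in\mathcal{D}_\gamma(A_{x_0})$ and $f(x_0)=\lim_{x\to x_0,\ x\in A_{x_0}}f(x)$. *)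

theory Defs
  imports "HOL-Analysis.Analysis" "HOL-Algebra.Module"
begin

text \<open>
  A modulus function lives on $[0,\infty)$; it is represented by a total function on the reals
  of which only the values at nonnegative arguments are constrained (and used).
\<close>

definition modulus_function :: "(real \<Rightarrow> real) \<Rightarrow> bool" where
  "modulus_function \<gamma> \<longleftrightarrow>
     (\<forall>a\<ge>0. \<gamma> a \<ge> 0) \<and>
     (\<forall>a\<ge>0. \<gamma> a = 0 \<longleftrightarrow> a = 0) \<and>
     (\<forall>a\<ge>0. \<forall>b\<ge>0. \<gamma> (a + b) \<le> \<gamma> a + \<gamma> b) \<and>
     continuous (at_right 0) \<gamma> \<and>
     mono_on {0..} \<gamma>"

text \<open>Only meaningful for Lebesgue measurable \<open>A\<close>; the sets measured then have finite measure.\<close>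

definition density_points :: "(real \<Rightarrow> real) \<Rightarrow> real set \<Rightarrow> real set" where
  "density_points \<gamma> A =
     {x. ((\<lambda>\<alpha>. \<gamma> (measure lebesgue ({x - \<alpha><..<x + \<alpha>} \<inter> - A)) / \<gamma> (2 * \<alpha>))
           \<longlongrightarrow> 0) (at_right 0)}"

definition approx_continuous_at :: "(real \<Rightarrow> real) \<Rightarrow> (real \<Rightarrow> real) \<Rightarrow> real \<Rightarrow> bool" where
  "approx_continuous_at \<gamma> f x\<^sub>0 \<longleftrightarrow>
     (\<exists>A \<in> sets lebesgue. x\<^sub>0 \<in> density_points \<gamma> A \<and> (f \<longlongrightarrow> f x\<^sub>0) (at x\<^sub>0 within A))"

definition approx_continuous_functions :: "(real \<Rightarrow> real) \<Rightarrow> (real \<Rightarrow> real) set" where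
  "approx_continuous_functions \<gamma> = {f. \<forall>x. approx_continuous_at \<gamma> f x}"

definition real_ring :: "real ring" where
  "real_ring = \<lparr>carrier = UNIV, monoid.mult = (*), one = 1, zero = 0, add = (+)\<rparr>"

text \<open>
  The record type of modules extends that of rings; its fields \<open>mult\<close> and \<open>one\<close> play no role
  in the locale \<open>module\<close>.
\<close>

definition pointwise_module :: "('a \<Rightarrow> real) set \<Rightarrow> (real, 'a \<Rightarrow> real) module" where
  "pointwise_module S =
     \<lparr>carrier = S, monoid.mult = undefined, one = undefined,
      zero = (\<lambda>x. 0), add = (\<lambda>f g x. f x + g x), smult = (\<lambda>c f x. c * f x)\<rparr>"

definition vector_space_over :: "('k, 'm) ring_scheme \<Rightarrow> ('k, 'v, 'n) module_scheme \<Rightarrow> bool" where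
  "vector_space_over K V \<longleftrightarrow> field K \<and> Module.module K V"

end

theory Submission
  imports Defs
begin

text \<open>
  Approximate continuity at a point is convergence along a set that has the point as a
  \<open>\<gamma>\<close>-density point. If \<open>f\<close> converges along \<open>A\<close> and \<open>g\<close> along \<open>B\<close>, then both converge along
  \<open>A \<inter> B\<close>, where the ordinary limit laws apply; so everything reduces to the fact that the sets
  with a given \<open>\<gamma>\<close>-density point are closed under intersection (\<open>density_points_Int\<close>). For this
  the complement of \<open>A \<inter> B\<close> is the union of the two complements, and monotonicity and
  subadditivity of \<open>\<gamma>\<close> bound its density ratio by the sum of the ratios for \<open>A\<close> and \<open>B\<close>. The
  vector space laws themselves are inherited pointwise from the field of real numbers.
\<close>

lemma density_points_UNIV:
  assumes "modulus_function \<gamma>"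
  shows "density_points \<gamma> UNIV = UNIV"
proof -
  have "\<gamma> 0 = 0"
    using assms by (simp add: modulus_function_def)
  then show ?thesis
    by (simp add: density_points_def)
qed

lemma modulus_measure_Un_le:
  assumes \<gamma>: "modulus_function \<gamma>"
    and "S \<in> lmeasurable" "T \<in> lmeasurable"
  shows "\<gamma> (measure lebesgue (S \<union> T)) \<le> \<gamma> (measure lebesgue S) + \<gamma> (measure lebesgue T)"
proof -
  have "\<gamma> (measure lebesgue (S \<union> T)) \<le> \<gamma> (measure lebesgue S + measure lebesgue T)"
    using \<gamma> measure_Un_le[of S lebesgue T] assms(2,3)
    by (auto simp: modulus_function_def fmeasurableD intro!: mono_onD[of "{0..}" \<gamma>])
  also have "\<dots> \<le> \<gamma> (measure lebesgue S) + \<gamma> (measure lebesgue T)"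
    using \<gamma> by (simp add: modulus_function_def)
  finally show ?thesis .
qed

text \<open>
  For nonmeasurable \<open>A\<close> and \<open>B\<close> this can fail: measurability is what makes \<open>measure lebesgue\<close>
  subadditive on the two complements.
\<close>

lemma density_points_Int:
  assumes \<gamma>: "modulus_function \<gamma>"
    and A: "A \<in> sets lebesgue" and B: "B \<in> sets lebesgue"
    and xA: "x \<in> density_points \<gamma> A" and xB: "x \<in> density_points \<gamma> B"
  shows "x \<in> density_points \<gamma> (A \<inter> B)"
proof -
  define I where "I \<alpha> = {x - \<alpha><..<x + \<alpha>}" for \<alpha>
  define r where "r S \<alpha> = \<gamma> (measure lebesgue (I \<alpha> \<inter> - S)) / \<gamma> (2 * \<alpha>)" for S \<alpha>
  have density_iff: "x \<in> density_points \<gamma> S \<longleftrightarrow> (r S \<longlongrightarrow> 0) (at_right 0)" for S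
    by (simp add: density_points_def r_def[abs_def] I_def)
  have \<gamma>_nonneg: "\<gamma> a \<ge> 0" if "a \<ge> 0" for a
    using \<gamma> that by (simp add: modulus_function_def)
  have meas: "I \<alpha> \<inter> - S \<in> lmeasurable" if "S \<in> sets lebesgue" for S \<alpha>
    using that unfolding I_def
    by (intro bounded_set_imp_lmeasurable)
       (auto intro: bounded_subset[OF bounded_box] simp: Compl_in_sets_lebesgue bounded_Int)
  have "r (A \<inter> B) \<alpha> \<le> r A \<alpha> + r B \<alpha>" if "\<alpha> > 0" for \<alpha>
  proof -
    have "I \<alpha> \<inter> - (A \<inter> B) = (I \<alpha> \<inter> - A) \<union> (I \<alpha> \<inter> - B)"
      by blast
    then show ?thesis
      using modulus_measure_Un_le[OF \<gamma> meas[OF A] meas[OF B], of \<alpha> \<alpha>] \<gamma>_nonneg[of "2 * \<alpha>"] that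
      by (simp add: r_def divide_right_mono flip: add_divide_distrib)
  qed
  then have upper: "\<forall>\<^sub>F \<alpha> in at_right 0. r (A \<inter> B) \<alpha> \<le> r A \<alpha> + r B \<alpha>"
    by (simp add: eventually_at_filter)
  have lower: "\<forall>\<^sub>F \<alpha> in at_right 0. 0 \<le> r (A \<inter> B) \<alpha>"
    by (simp add: eventually_at_filter r_def \<gamma>_nonneg)
  have "(r A \<longlongrightarrow> 0) (at_right 0)" "(r B \<longlongrightarrow> 0) (at_right 0)"
    using xA xB by (simp_all add: density_iff)
  then have "((\<lambda>\<alpha>. r A \<alpha> + r B \<alpha>) \<longlongrightarrow> 0) (at_right 0)"
    by (rule tendsto_add_zero)
  then have "(r (A \<inter> B) \<longlongrightarrow> 0) (at_right 0)"
    by (rule tendsto_sandwich[OF lower upper tendsto_const])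
  then show ?thesis
    by (simp add: density_iff)
qed

lemma approx_continuous_at_const:
  assumes "modulus_function \<gamma>"
  shows "approx_continuous_at \<gamma> (\<lambda>x. c) x\<^sub>0"
  unfolding approx_continuous_at_def
  by (rule bexI[of _ UNIV]) (simp_all add: density_points_UNIV[OF assms])

lemma approx_continuous_at_add:
  assumes \<gamma>: "modulus_function \<gamma>"
    and f: "approx_continuous_at \<gamma> f x\<^sub>0" and g: "approx_continuous_at \<gamma> g x\<^sub>0"
  shows "approx_continuous_at \<gamma> (\<lambda>x. f x + g x) x\<^sub>0"
proof -
  obtain A where A: "A \<in> sets lebesgue" "x\<^sub>0 \<in> density_points \<gamma> A"
    and limf: "(f \<longlongrightarrow> f x\<^sub>0) (at x\<^sub>0 within A)"
    using f by (auto simp: approx_continuous_at_def)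
  obtain B where B: "B \<in> sets lebesgue" "x\<^sub>0 \<in> density_points \<gamma> B"
    and limg: "(g \<longlongrightarrow> g x\<^sub>0) (at x\<^sub>0 within B)"
    using g by (auto simp: approx_continuous_at_def)
  have "((\<lambda>x. f x + g x) \<longlongrightarrow> f x\<^sub>0 + g x\<^sub>0) (at x\<^sub>0 within A \<inter> B)"
    by (intro tendsto_add tendsto_within_subset[OF limf] tendsto_within_subset[OF limg]) auto
  then show ?thesis
    using density_points_Int[OF \<gamma> A(1) B(1) A(2) B(2)] A(1) B(1)
    unfolding approx_continuous_at_def by blast
qed

lemma approx_continuous_at_cmult:
  assumes "approx_continuous_at \<gamma> f x\<^sub>0"
  shows "approx_continuous_at \<gamma> (\<lambda>x. c * f x) x\<^sub>0"
  using assms by (auto simp: approx_continuous_at_def intro: tendsto_mult_left)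

lemma field_real_ring: "field real_ring"
proof (rule cring.cring_fieldI2)
  show "cring real_ring"
  proof (rule cringI)
    show "abelian_group real_ring"
    proof (rule abelian_groupI)
      fix x assume "x \<in> carrier real_ring"
      show "\<exists>y\<in>carrier real_ring. y \<oplus>\<^bsub>real_ring\<^esub> x = \<zero>\<^bsub>real_ring\<^esub>"
        by (rule bexI[of _ "- x"]) (simp_all add: real_ring_def)
    qed (simp_all add: real_ring_def)
    show "comm_monoid real_ring"
      by (rule comm_monoidI) (simp_all add: real_ring_def)
  qed (simp add: real_ring_def algebra_simps)
  show "\<zero>\<^bsub>real_ring\<^esub> \<noteq> \<one>\<^bsub>real_ring\<^esub>"
    by (simp add: real_ring_def)
  fix a assume "a \<in> carrier real_ring" "a \<noteq> \<zero>\<^bsub>real_ring\<^esub>"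
  then show "\<exists>b\<in>carrier real_ring. a \<otimes>\<^bsub>real_ring\<^esub> b = \<one>\<^bsub>real_ring\<^esub>"
    by (intro bexI[of _ "inverse a"]) (simp_all add: real_ring_def)
qed

text \<open>
  The subspace criterion: closure under negation is the case \<open>c = - 1\<close> of closure under scaling.
\<close>

lemma module_pointwise_moduleI:
  assumes zero: "(\<lambda>x. 0) \<in> S"
    and add: "\<And>f g. f \<in> S \<Longrightarrow> g \<in> S \<Longrightarrow> (\<lambda>x. f x + g x) \<in> S"
    and smult: "\<And>c f. f \<in> S \<Longrightarrow> (\<lambda>x. c * f x) \<in> S"
  shows "Module.module real_ring (pointwise_module S)"
proof (rule module.intro)
  show "cring real_ring"
    using field_real_ring by (rule fieldE(1))
  show "abelian_group (pointwise_module S)"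
  proof (rule abelian_groupI)
    fix f assume "f \<in> carrier (pointwise_module S)"
    then show "\<exists>g\<in>carrier (pointwise_module S).
        g \<oplus>\<^bsub>pointwise_module S\<^esub> f = \<zero>\<^bsub>pointwise_module S\<^esub>"
      using smult[of f "- 1"]
      by (intro bexI[of _ "\<lambda>x. - 1 * f x"]) (simp_all add: pointwise_module_def)
  qed (simp_all add: pointwise_module_def zero add add_ac)
  show "module_axioms real_ring (pointwise_module S)"
    by (rule module_axioms.intro)
       (simp_all add: pointwise_module_def real_ring_def smult algebra_simps)
qed

theorem theorem17:
  fixes \<gamma> :: "real \<Rightarrow> real"
  assumes "modulus_function \<gamma>"
  shows "vector_space_over real_ring (pointwise_module (approx_continuous_functions \<gamma>))"
  unfolding vector_space_over_def
  using field_real_ring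
  by (auto simp: approx_continuous_functions_def
      intro!: module_pointwise_moduleI approx_continuous_at_const[OF assms]
        approx_continuous_at_add[OF assms] approx_continuous_at_cmult)

end
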